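(* Let $d\ge2$, let $\Omega\subset\mathbb{R}^d$ be a bounded open set with Lipschitz boundary, and let $\mu$ be a probability measure supported on $\overline\Omega$ with a density $\rho$ with respect to Lebesgue measure that is continuous on $\overline\Omega$ and satisfies $0<c\le\rho(x)\le C<\infty$ for all $x\in\overline\Omega$. Let $\{\varepsilon_n\}$ be positive numbers converging to $0$ with $\lim_{n\to\infty}\frac{(\log n)^{1/d}}{\varepsilon_n n^{1/d}}=0$. Let $\{x_i\}_{i\in\mathbb{N}}$ be i.i.d. random points with density $\rho$ and $\mu_n=\frac1n\sum_{i=1}^n\delta_{x_i}$. Then there exists a sequence of (random) probability measures $\tilde\mu_n$, absolutely continuous with respect to $\mu$, such that (i) almost surely, $d_\infty(\mu_n,\tilde\mu_n)/\varepsilon_n\to0$ as $n\to\infty$; (ii) almost surely, $\frac{d\tilde\mu_n}{d\mu}$ converges to $1$ uniformly on $\overline\Omega$ as $n\to\infty$.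
   Context: $d_\infty$ is the $\infty$-transportation (Wasserstein) distance: $d_\infty(\nu,\nu')=\inf_{\gamma}\operatorname{ess\,sup}_{\gamma}|x-y|$, the infimum being over all couplings $\gamma$ of $\nu$ and $\nu'$. *)

theory Defs
  imports "HOL-Probability.Probability"
begin

text \<open>
  Near each boundary point the set is, in suitable Cartesian coordinates, the strict epigraph of
  a Lipschitz function. The coordinates are the height \<open>x \<bullet> u\<close> along a unit vector \<open>u\<close> and
  the orthogonal projection of \<open>x\<close> to the hyperplane orthogonal to \<open>u\<close>.
\<close>

definition lipschitz_boundary :: "'a::euclidean_space set \<Rightarrow> bool" where
  "lipschitz_boundary S \<longleftrightarrow>
     (\<forall>p\<in>frontier S. \<exists>r>0. \<exists>u g L. norm u = 1 \<and>
        L-lipschitz_on {y. y \<bullet> u = 0} (g :: 'a \<Rightarrow> real) \<and>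
        S \<inter> ball p r = {x \<in> ball p r. g (x - (x \<bullet> u) *\<^sub>R u) < x \<bullet> u})"

definition empirical_measure :: "nat \<Rightarrow> (nat \<Rightarrow> 'a::topological_space) \<Rightarrow> 'a measure" where
  "empirical_measure n x =
     measure_of UNIV (sets borel) (\<lambda>A. (\<Sum>i=1..n. emeasure (return borel (x i)) A) / of_nat n)"

lemma sets_empirical_measure [simp, measurable_cong]:
  "sets (empirical_measure n x) = sets borel"
  using sets.sigma_sets_eq[of "borel :: 'a measure"]
  by (simp add: empirical_measure_def sets_measure_of_conv)

lemma space_empirical_measure [simp]: "space (empirical_measure n x) = UNIV"
  using sets_eq_imp_space_eq[OF sets_empirical_measure[of n x]] by simp

lemma emeasure_empirical_measure:
  assumes "A \<in> sets borel"
  shows "emeasure (empirical_measure n x) A =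
           (\<Sum>i=1..n. emeasure (return borel (x i)) A) / of_nat n"
  unfolding empirical_measure_def
proof (rule emeasure_measure_of_sigma)
  let ?f = "\<lambda>A. (\<Sum>i=1..n. emeasure (return borel (x i)) A) / of_nat n"
  show "sigma_algebra UNIV (sets (borel :: 'a measure))"
    using sets.sigma_algebra_axioms[of "borel :: 'a measure"] by simp
  show "positive (sets borel) ?f"
    by (simp add: positive_def)
  show "countably_additive (sets borel) ?f"
  proof (rule countably_additiveI)
    fix B :: "nat \<Rightarrow> 'a set"
    assume B: "range B \<subseteq> sets borel" "disjoint_family B"
    have "(\<Sum>k. ?f (B k)) = (\<Sum>k. \<Sum>i=1..n. emeasure (return borel (x i)) (B k)) / of_nat n"
      unfolding divide_ennreal_def by simp
    also have "(\<Sum>k. \<Sum>i=1..n. emeasure (return borel (x i)) (B k)) =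
        (\<Sum>i=1..n. \<Sum>k. emeasure (return borel (x i)) (B k))"
      by (rule suminf_sum) simp
    also have "\<dots> = (\<Sum>i=1..n. emeasure (return borel (x i)) (\<Union>k. B k))"
      using B by (intro sum.cong refl suminf_emeasure) auto
    finally show "(\<Sum>k. ?f (B k)) = ?f (\<Union>k. B k)" .
  qed
qed (use assms in simp)

definition couplings :: "'a measure \<Rightarrow> 'b measure \<Rightarrow> ('a \<times> 'b) measure set" where
  "couplings M N =
     {\<gamma>. sets \<gamma> = sets (M \<Otimes>\<^sub>M N) \<and> distr \<gamma> M fst = M \<and> distr \<gamma> N snd = N}"

definition d_infty :: "'a::metric_space measure \<Rightarrow> 'a measure \<Rightarrow> ennreal" where
  "d_infty M N = (INF \<gamma>\<in>couplings M N. esssup \<gamma> (\<lambda>(x, y). ennreal (dist x y)))"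

text \<open>
  \<^const>\<open>RN_deriv\<close> picks an unspecified member of the almost-everywhere class, so pointwise
  statements about a density have to speak of a version of it.
\<close>

definition RN_version :: "'a measure \<Rightarrow> 'a measure \<Rightarrow> ('a \<Rightarrow> real) \<Rightarrow> bool" where
  "RN_version M N f \<longleftrightarrow>
     f \<in> borel_measurable M \<and> (\<forall>x. 0 \<le> f x) \<and> (AE x in M. ennreal (f x) = RN_deriv M N x)"

end

theory Submission
  imports Defs
begin

text \<open>
  Cut \<open>closure \<Omega>\<close> into Voronoi-like cells, each containing a ball of radius \<open>\<delta> / 2\<close> and contained in
  one of radius \<open>2 * \<delta>\<close>, and spread the mass that \<open>\<mu>\<^sub>n\<close> gives to a cell over that cell proportionally
  to \<open>\<mu>\<close>. Mass moves only inside cells, so the transport distance is at most \<open>4 * \<delta>\<close>, and the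
  density of the new measure is the ratio \<open>\<mu>\<^sub>n Q / \<mu> Q\<close> on the cell \<open>Q\<close>. A Lipschitz domain contains
  interior balls of comparable size near each point of its closure, so \<open>\<mu> Q\<close> is at least of order
  \<open>\<delta> ^ d\<close> even for cells at the boundary. A multiplicative Chernoff bound, a union bound over the
  cells and Borel-Cantelli give uniform convergence of the ratios to 1 as soon as
  \<open>n * \<delta> ^ d / ln n\<close> tends to infinity; this leaves room for \<open>\<delta> / \<epsilon>\<close> to tend to 0.
\<close>

section \<open>Chernoff bounds for counts of independent hits\<close>

text \<open>For negative \<open>x\<close> put \<open>y = - x\<close> and multiply by
  \<open>exp y\<close>: since \<open>1 + y \<le> exp y\<close>, it is enough that
  \<open>(1 + y) * (1 - y + y\<^sup>2) = 1 + y ^ 3\<close> is at least 1.\<close>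

lemma exp_le_one_plus_square:
  fixes x :: real
  assumes "\<bar>x\<bar> \<le> 1"
  shows "exp x \<le> 1 + x + x\<^sup>2"
proof (cases "x \<ge> 0")
  case True
  then show ?thesis using exp_bound assms by simp
next
  case False
  define y where "y = - x"
  have y: "0 < y" "y \<le> 1" using False assms by (auto simp: y_def)
  have "1 \<le> (1 + y) * (1 - y + y\<^sup>2)"
    using y by (simp add: algebra_simps power2_eq_square)
  also have "\<dots> \<le> exp y * (1 - y + y\<^sup>2)"
  proof (rule mult_right_mono)
    show "0 \<le> 1 - y + y\<^sup>2" using y by (simp add: add_nonneg_nonneg)
  qed (rule exp_ge_add_one_self)
  finally have "exp (- y) \<le> 1 - y + y\<^sup>2"
    by (simp add: exp_minus field_simps)
  then show ?thesis by (simp add: y_def)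
qed

text \<open>Markov's inequality for the exponential of \<open>l\<close> times the count.
  Independence factorises the expectation, and each factor is
  \<open>1 + p * (exp l - 1) \<le> exp (p * (exp l - 1))\<close>. The sign of \<open>l\<close> is
  left free so that one statement serves both tails.\<close>

lemma (in prob_space) exponential_Markov_count:
  fixes X :: "'i \<Rightarrow> 'a \<Rightarrow> 'b::topological_space"
  assumes I: "finite I" and ind: "indep_vars (\<lambda>_. borel) X I"
    and A [measurable]: "A \<in> sets borel"
    and p: "\<And>i. i \<in> I \<Longrightarrow> prob {\<omega> \<in> space M. X i \<omega> \<in> A} = p"
  shows "prob {\<omega> \<in> space M. a \<le> l * (\<Sum>i\<in>I. indicator A (X i \<omega>))}
           \<le> exp (- a + real (card I) * p * (exp l - 1))"
proof -
  have X [measurable]: "X i \<in> borel_measurable M" if "i \<in> I" for i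
    using ind that by (auto simp: indep_vars_def)
  define S where "S \<omega> = (\<Sum>i\<in>I. indicator A (X i \<omega>) :: real)" for \<omega>
  have [measurable]: "S \<in> borel_measurable M" unfolding S_def by measurable
  have one: "(\<integral>\<^sup>+\<omega>. ennreal (exp (l * indicator A (X i \<omega>))) \<partial>M) \<le> ennreal (exp (p * (exp l - 1)))"
    if i: "i \<in> I" for i
  proof -
    note [measurable] = X[OF i]
    have int: "integrable M (\<lambda>\<omega>. 1 + (exp l - 1) * indicator {\<omega> \<in> space M. X i \<omega> \<in> A} \<omega> :: real)"
      by (intro Bochner_Integration.integrable_add integrable_mult_right integrable_real_indicator)
        (auto simp: emeasure_eq_measure)
    \<comment> \<open>An indicator takes only the values 0 and 1, so its exponential is affine in it
      and the expectation is explicit.\<close>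
    have eq: "exp (l * indicator A (X i \<omega>)) = 1 + (exp l - 1) * indicator {\<omega> \<in> space M. X i \<omega> \<in> A} \<omega>"
      if "\<omega> \<in> space M" for \<omega>
      using that by (auto simp: indicator_def)
    have "(\<integral>\<^sup>+\<omega>. ennreal (exp (l * indicator A (X i \<omega>))) \<partial>M) =
        (\<integral>\<^sup>+\<omega>. ennreal (1 + (exp l - 1) * indicator {\<omega> \<in> space M. X i \<omega> \<in> A} \<omega>) \<partial>M)"
      by (intro nn_integral_cong) (simp add: eq)
    also have "\<dots> = ennreal (expectation (\<lambda>\<omega>. 1 + (exp l - 1) * indicator {\<omega> \<in> space M. X i \<omega> \<in> A} \<omega>))"
      by (rule nn_integral_eq_integral[OF int]) (auto simp: eq[symmetric])
    also have "expectation (\<lambda>\<omega>. 1 + (exp l - 1) * indicator {\<omega> \<in> space M. X i \<omega> \<in> A} \<omega>) = 1 + (exp l - 1) * p"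
      by (subst Bochner_Integration.integral_add)
        (auto simp: p[OF i] prob_space emeasure_eq_measure Int_def conj_commute)
    also have "\<dots> \<le> exp (p * (exp l - 1))"
      using exp_ge_add_one_self[of "p * (exp l - 1)"] by (simp add: mult.commute)
    finally show ?thesis by (simp add: ennreal_leI)
  qed
  have "emeasure M {\<omega> \<in> space M. a \<le> l * S \<omega>} = (\<integral>\<^sup>+\<omega>. indicator {\<omega> \<in> space M. a \<le> l * S \<omega>} \<omega> \<partial>M)"
    by (rule nn_integral_indicator[symmetric]) measurable
  also have "\<dots> \<le> (\<integral>\<^sup>+\<omega>. ennreal (exp (- a)) * (\<Prod>i\<in>I. ennreal (exp (l * indicator A (X i \<omega>)))) \<partial>M)"
  proof (rule nn_integral_mono)
    fix \<omega> assume "\<omega> \<in> space M"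
    have "ennreal (exp (- a)) * (\<Prod>i\<in>I. ennreal (exp (l * indicator A (X i \<omega>)))) = ennreal (exp (- a + l * S \<omega>))"
      unfolding S_def sum_distrib_left exp_add exp_sum[OF I] by (simp add: prod_ennreal ennreal_mult prod_nonneg)
    then show "indicator {\<omega> \<in> space M. a \<le> l * S \<omega>} \<omega>
        \<le> ennreal (exp (- a)) * (\<Prod>i\<in>I. ennreal (exp (l * indicator A (X i \<omega>))))"
      by (auto simp: indicator_def simp flip: ennreal_1 intro!: ennreal_leI)
  qed
  also have "\<dots> = ennreal (exp (- a)) * (\<integral>\<^sup>+\<omega>. (\<Prod>i\<in>I. ennreal (exp (l * indicator A (X i \<omega>)))) \<partial>M)"
    by (rule nn_integral_cmult) measurable
  also have "(\<integral>\<^sup>+\<omega>. (\<Prod>i\<in>I. ennreal (exp (l * indicator A (X i \<omega>)))) \<partial>M)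
      = (\<Prod>i\<in>I. \<integral>\<^sup>+\<omega>. ennreal (exp (l * indicator A (X i \<omega>))) \<partial>M)"
    by (rule indep_vars_nn_integral[OF I indep_vars_compose2[OF ind]]) auto
  also have "\<dots> \<le> (\<Prod>i\<in>I. ennreal (exp (p * (exp l - 1))))"
    by (intro prod_mono_ennreal one)
  also have "ennreal (exp (- a)) * \<dots> = ennreal (exp (- a + real (card I) * p * (exp l - 1)))"
    by (simp add: ennreal_power exp_add exp_diff exp_minus field_simps exp_of_nat_mult[symmetric] flip: ennreal_mult)
  finally show ?thesis
    unfolding S_def by (simp add: emeasure_eq_measure mult_left_mono)
qed

text \<open>With \<open>l = s * \<eta> / 2\<close> the bound
  \<open>exp l - 1 \<le> l + l\<^sup>2\<close> leaves the exponent
  \<open>- m * l\<^sup>2 = - m * \<eta>\<^sup>2 / 4\<close> in each tail; the factor 2 counts the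
  two tails.\<close>

lemma (in prob_space) multiplicative_Chernoff:
  fixes X :: "'i \<Rightarrow> 'a \<Rightarrow> 'b::topological_space" and p \<eta> :: real
  assumes I: "finite I" and ind: "indep_vars (\<lambda>_. borel) X I"
    and A [measurable]: "A \<in> sets borel"
    and p: "\<And>i. i \<in> I \<Longrightarrow> prob {\<omega> \<in> space M. X i \<omega> \<in> A} = p"
    and p0: "0 \<le> p" and \<eta>: "0 \<le> \<eta>" "\<eta> \<le> 1"
  shows "prob {\<omega> \<in> space M. \<eta> * (card I * p) \<le> \<bar>(\<Sum>i\<in>I. indicator A (X i \<omega>)) - card I * p\<bar>}
           \<le> 2 * exp (- (card I * p * \<eta>\<^sup>2 / 4))"
proof -
  have X [measurable]: "X i \<in> borel_measurable M" if "i \<in> I" for i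
    using ind that by (auto simp: indep_vars_def)
  define S where "S \<omega> = (\<Sum>i\<in>I. indicator A (X i \<omega>) :: real)" for \<omega>
  have [measurable]: "S \<in> borel_measurable M" unfolding S_def by measurable
  define m where "m = real (card I) * p"
  have m: "0 \<le> m" by (simp add: m_def p0)
  \<comment> \<open>Exponent \<open>\<eta> / 2\<close> for the upper tail and \<open>- \<eta> / 2\<close> for the lower one.\<close>
  have tail: "prob {\<omega> \<in> space M. s * (\<eta> / 2) * ((1 + s * \<eta>) * m) \<le> s * (\<eta> / 2) * S \<omega>} \<le> exp (- (m * \<eta>\<^sup>2 / 4))"
    if s: "s = 1 \<or> s = - 1" for s :: real
  proof -
    define l where "l = s * (\<eta> / 2)"
    have l: "\<bar>l\<bar> \<le> 1" "s * \<eta> = 2 * l" "\<eta>\<^sup>2 = 4 * l\<^sup>2" using s \<eta> by (auto simp: l_def power2_eq_square)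
    have "m * (exp l - 1) \<le> m * (l + l\<^sup>2)"
      using exp_le_one_plus_square[OF l(1)] m by (intro mult_left_mono) auto
    then have "- (l * ((1 + 2 * l) * m)) + m * (exp l - 1) \<le> - (m * l\<^sup>2)"
      by (simp add: algebra_simps power2_eq_square)
    with exponential_Markov_count[OF I ind A p, of "l * ((1 + 2 * l) * m)" l]
    show ?thesis
      unfolding l(2) l(3) l_def[symmetric] S_def m_def[symmetric]
      by (simp add: mult.assoc) (smt (verit) exp_le_cancel_iff)
  qed
  have "{\<omega> \<in> space M. \<eta> * m \<le> \<bar>S \<omega> - m\<bar>} \<subseteq>
      {\<omega> \<in> space M. 1 * (\<eta> / 2) * ((1 + 1 * \<eta>) * m) \<le> 1 * (\<eta> / 2) * S \<omega>} \<union>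
      {\<omega> \<in> space M. - 1 * (\<eta> / 2) * ((1 + - 1 * \<eta>) * m) \<le> - 1 * (\<eta> / 2) * S \<omega>}" (is "_ \<subseteq> ?U \<union> ?V")
  \<comment> \<open>Failure of the lower-tail event is a strict inequality, which rules out
    \<open>\<eta> = 0\<close>. Dividing by \<open>\<eta> / 2\<close> then shows that the deviation
    must be upward.\<close>
  proof safe
    fix \<omega> assume h: "\<eta> * m \<le> \<bar>S \<omega> - m\<bar>" "\<not> - 1 * (\<eta> / 2) * ((1 + - 1 * \<eta>) * m) \<le> - 1 * (\<eta> / 2) * S \<omega>"
    from h(2) have "(\<eta> / 2) * ((1 - \<eta>) * m) < (\<eta> / 2) * S \<omega>" by simp
    then have "(1 - \<eta>) * m < S \<omega>" using \<eta> by (simp add: mult_less_cancel_left)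
    with h(1) have "(1 + \<eta>) * m \<le> S \<omega>"
      by (cases "S \<omega> \<le> m") (simp_all add: algebra_simps)
    then show "1 * (\<eta> / 2) * ((1 + 1 * \<eta>) * m) \<le> 1 * (\<eta> / 2) * S \<omega>"
      using \<eta> by (simp add: mult_left_mono)
  qed
  then have "prob {\<omega> \<in> space M. \<eta> * m \<le> \<bar>S \<omega> - m\<bar>} \<le> prob (?U \<union> ?V)"
    by (rule finite_measure_mono) measurable
  also have "\<dots> \<le> prob ?U + prob ?V"
    by (rule measure_Un_le) measurable
  also have "\<dots> \<le> exp (- (m * \<eta>\<^sup>2 / 4)) + exp (- (m * \<eta>\<^sup>2 / 4))"
    using tail[of 1] tail[of "- 1"] by (intro add_mono) simp_all
  finally show ?thesis by (simp add: S_def m_def)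
qed

section \<open>Partition of a compact set into cells of controlled size\<close>

text \<open>Take a maximal separated subset \<open>Y\<close> of a finite \<open>\<delta>\<close>-net
  \<open>F\<close>; maximal subsets exist because \<open>F\<close> is finite. Maximality puts every
  point of \<open>F\<close> within \<open>\<delta>\<close> of \<open>Y\<close>, hence every point of
  \<open>K\<close> within \<open>2 * \<delta>\<close>.\<close>

lemma finite_separated_net:
  fixes K :: "'a::metric_space set"
  assumes "compact K" "0 < \<delta>"
  obtains Y where "finite Y" "Y \<subseteq> K" "K \<subseteq> (\<Union>y\<in>Y. ball y (2 * \<delta>))"
    "\<And>y z. y \<in> Y \<Longrightarrow> z \<in> Y \<Longrightarrow> y \<noteq> z \<Longrightarrow> \<delta> \<le> dist y z"
proof -
  obtain F where F: "finite F" "F \<subseteq> K" "K \<subseteq> (\<Union>y\<in>F. ball y \<delta>)"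
    by (rule compactE_image[OF assms(1), of K "\<lambda>y. ball y \<delta>"]) (use assms(2) in auto)
  define sep where "sep Y \<longleftrightarrow> (\<forall>y\<in>Y. \<forall>z\<in>Y. y \<noteq> z \<longrightarrow> \<delta> \<le> dist y z)" for Y :: "'a set"
  have "finite {Y. Y \<subseteq> F \<and> sep Y}" "{} \<in> {Y. Y \<subseteq> F \<and> sep Y}"
    using F(1) by (auto simp: sep_def)
  then obtain Y where "Y \<in> {Y. Y \<subseteq> F \<and> sep Y}" "\<forall>Z\<in>{Y. Y \<subseteq> F \<and> sep Y}. Y \<subseteq> Z \<longrightarrow> Y = Z"
    using finite_has_maximal[of "{Y. Y \<subseteq> F \<and> sep Y}"] by blast
  then have Y: "Y \<subseteq> F" "sep Y" "\<And>Z. Z \<subseteq> F \<Longrightarrow> sep Z \<Longrightarrow> Y \<subseteq> Z \<Longrightarrow> Z = Y"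
    by auto
  have near: "\<exists>y\<in>Y. dist y z < \<delta>" if "z \<in> F" for z
  proof (rule ccontr)
    assume "\<not> ?thesis"
    then have far: "\<And>y. y \<in> Y \<Longrightarrow> \<delta> \<le> dist y z" by (auto simp: not_less)
    then have "sep (insert z Y)" using Y(2) by (auto simp: sep_def dist_commute)
    then have "z \<in> Y" using Y(1) Y(3)[of "insert z Y"] that by auto
    then show False using far[of z] assms(2) by simp
  qed
  show ?thesis
  proof
    show "K \<subseteq> (\<Union>y\<in>Y. ball y (2 * \<delta>))"
    proof
      fix x assume "x \<in> K"
      then obtain z where z: "z \<in> F" "dist z x < \<delta>" using F(3) by (auto simp: ball_def)
      then obtain y where "y \<in> Y" "dist y z < \<delta>" using near by blast
      then show "x \<in> (\<Union>y\<in>Y. ball y (2 * \<delta>))"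
        using z dist_triangle[of y x z] by force
    qed
  qed (use F Y in \<open>auto simp: sep_def intro: finite_subset\<close>)
qed

lemma compact_cell_partition:
  fixes K :: "'a::metric_space set"
  assumes "compact K" "0 < \<delta>"
  obtains m y Q where "\<And>j. j < m \<Longrightarrow> y j \<in> K" "\<And>j. Q j \<in> sets borel"
    "\<And>j. j < m \<Longrightarrow> ball (y j) (\<delta> / 2) \<subseteq> Q j" "\<And>j. j < m \<Longrightarrow> Q j \<subseteq> ball (y j) (2 * \<delta>)"
    "disjoint_family_on Q {..<m::nat}" "K \<subseteq> (\<Union>j<m. Q j)"
proof -
  obtain Y where Y: "finite Y" "Y \<subseteq> K" "K \<subseteq> (\<Union>y\<in>Y. ball y (2 * \<delta>))"
    "\<And>y z. y \<in> Y \<Longrightarrow> z \<in> Y \<Longrightarrow> y \<noteq> z \<Longrightarrow> \<delta> \<le> dist y z"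
    using finite_separated_net[OF assms] by metis
  define m where "m = card Y"
  obtain y where "bij_betw y {..<m} Y"
    using ex_bij_betw_nat_finite[OF Y(1)] by (auto simp: m_def atLeast0LessThan)
  then have inj: "inj_on y {..<m}" and img: "y ` {..<m} = Y" by (auto simp: bij_betw_def)
  define B where "B j = ball (y j) (\<delta> / 2)" for j
  \<comment> \<open>The small balls are reserved for their own cells first. Any other point goes to
    the least index whose large ball contains it, which settles ties and keeps the cells
    Borel.\<close>
  define Q where "Q j = B j \<union> (ball (y j) (2 * \<delta>) - (\<Union>i<m. B i) - (\<Union>i<j. ball (y i) (2 * \<delta>)))" for j
  \<comment> \<open>This is where the separation of the centres enters: balls of half the separation
    cannot meet.\<close>
  have disjB: "B i \<inter> B j = {}" if "i < m" "j < m" "i \<noteq> j" for i j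
  proof -
    have "\<delta> \<le> dist (y i) (y j)"
      using that inj img by (intro Y(4)) (auto dest: inj_onD)
    then show ?thesis
      using dist_triangle_half_r[of _ "y i" \<delta> "y j"] by (force simp: B_def dist_commute)
  qed
  show ?thesis
  proof
    show "y j \<in> K" if "j < m" for j using that img Y(2) by auto
    show "Q j \<in> sets borel" for j unfolding Q_def B_def by measurable
    show "ball (y j) (\<delta> / 2) \<subseteq> Q j" if "j < m" for j by (auto simp: Q_def B_def)
    show "Q j \<subseteq> ball (y j) (2 * \<delta>)" if "j < m" for j using assms(2) by (auto simp: Q_def B_def)
    have "Q i \<inter> Q j = {}" if "i < j" "j < m" for i j
      using that disjB[of i j] unfolding Q_def by auto
    then show "disjoint_family_on Q {..<m}"
      unfolding disjoint_family_on_def by (metis Int_commute lessThan_iff nat_neq_iff)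
    show "K \<subseteq> (\<Union>j<m. Q j)"
    proof
      fix x assume x: "x \<in> K"
      show "x \<in> (\<Union>j<m. Q j)"
      proof (cases "x \<in> (\<Union>i<m. B i)")
        case True
        then show ?thesis by (auto simp: Q_def)
      next
        case False
        define j where "j = (LEAST j. j < m \<and> x \<in> ball (y j) (2 * \<delta>))"
        have ex: "\<exists>j. j < m \<and> x \<in> ball (y j) (2 * \<delta>)"
          using x Y(3) img by blast
        have "j < m \<and> x \<in> ball (y j) (2 * \<delta>)"
          unfolding j_def by (rule LeastI_ex[OF ex])
        moreover have "x \<notin> ball (y i) (2 * \<delta>)" if "i < j" for i
          using not_less_Least[OF that[unfolded j_def]] that calculation by auto
        ultimately show ?thesis using False by (auto simp: Q_def)
      qed
    qed
  qed
qed

section \<open>Empirical measures as image measures\<close>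

text \<open>Seen as the image of the uniform distribution on the indices, the empirical measure
  inherits total mass 1 and a description of its null sets.\<close>

lemma empirical_measure_eq_distr:
  assumes "n \<ge> 1"
  shows "empirical_measure n x = distr (measure_pmf (pmf_of_set {1..n})) borel x"
proof (rule measure_eqI)
  fix A assume "A \<in> sets (empirical_measure n x)"
  then have A: "A \<in> sets borel" by simp
  have "emeasure (distr (measure_pmf (pmf_of_set {1..n})) borel x) A
      = (\<integral>\<^sup>+i. indicator (x -` A) i \<partial>measure_pmf (pmf_of_set {1..n}))"
    using A by (simp add: emeasure_distr)
  also have "\<dots> = (\<Sum>i=1..n. indicator (x -` A) i) / of_nat n"
    using assms by (subst nn_integral_pmf_of_set) auto
  finally show "emeasure (empirical_measure n x) A = emeasure (distr (measure_pmf (pmf_of_set {1..n})) borel x) A"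
    using A by (simp add: emeasure_empirical_measure indicator_vimage)
qed simp

lemma prob_space_empirical_measure: "n \<ge> 1 \<Longrightarrow> prob_space (empirical_measure n x)"
  by (simp add: empirical_measure_eq_distr measure_pmf.prob_space_distr)

lemma measure_empirical_measure:
  assumes "n \<ge> 1" and A: "A \<in> sets borel"
  shows "measure (empirical_measure n x) A = (\<Sum>i=1..n. indicator A (x i)) / real n"
proof -
  have "emeasure (empirical_measure n x) A = (\<Sum>i=1..n. ennreal (indicator A (x i))) / ennreal (real n)"
    by (simp add: emeasure_empirical_measure[OF A] A ennreal_indicator ennreal_of_nat_eq_real_of_nat)
  also have "\<dots> = ennreal ((\<Sum>i=1..n. indicator A (x i)) / real n)"
    using assms(1) by (simp add: divide_ennreal sum_nonneg)
  finally show ?thesis by (simp add: measure_def sum_nonneg)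
qed

section \<open>Transport inside the cells\<close>

text \<open>The sum of indicators makes measurability and integration a matter of linearity;
  \<open>cell_density_eq\<close> recovers the single ratio valid on a given cell.\<close>

definition cell_density :: "'i set \<Rightarrow> ('i \<Rightarrow> 'a set) \<Rightarrow> 'a measure \<Rightarrow> 'a measure \<Rightarrow> 'a \<Rightarrow> real" where
  "cell_density J Q \<nu> \<mu> y = (\<Sum>j\<in>J. measure \<nu> (Q j) / measure \<mu> (Q j) * indicator (Q j) y)"

lemma cell_density_nonneg: "0 \<le> cell_density J Q \<nu> \<mu> y"
  by (auto simp: cell_density_def intro!: sum_nonneg)

lemma cell_density_eq:
  assumes "finite J" "disjoint_family_on Q J" "j \<in> J" "y \<in> Q j"
  shows "cell_density J Q \<nu> \<mu> y = measure \<nu> (Q j) / measure \<mu> (Q j)"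
proof -
  have "y \<notin> Q i" if "i \<in> J" "i \<noteq> j" for i
    using assms that by (auto simp: disjoint_family_on_def)
  then have "cell_density J Q \<nu> \<mu> y = (\<Sum>i\<in>{j}. measure \<nu> (Q i) / measure \<mu> (Q i) * indicator (Q i) y)"
    unfolding cell_density_def using assms by (intro sum.mono_neutral_right) auto
  then show ?thesis using assms by simp
qed

text \<open>\<open>cells_\<nu>\<close> ensures that no mass of \<open>\<nu>\<close> is lost when it
  is collected cell by cell; \<open>pos\<close> ensures that the collected mass can be spread
  proportionally to \<open>\<mu>\<close>.\<close>

locale cell_transport =
  \<nu>: prob_space \<nu> + \<mu>: prob_space \<mu>
  for \<nu> \<mu> :: "'a::{second_countable_topology, metric_space} measure" +
  fixes J :: "'i set" and Q :: "'i \<Rightarrow> 'a set"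
  assumes sets_\<nu> [measurable_cong, simp]: "sets \<nu> = sets borel"
    and sets_\<mu> [measurable_cong, simp]: "sets \<mu> = sets borel"
    and J [simp]: "finite J"
    and Q_borel [measurable]: "\<And>j. Q j \<in> sets borel"
    and disjoint: "disjoint_family_on Q J"
    and cells_\<nu>: "AE x in \<nu>. x \<in> (\<Union>j\<in>J. Q j)"
    and pos: "\<And>j. j \<in> J \<Longrightarrow> 0 < measure \<mu> (Q j)"
begin

lemma space_eq [simp]: "space \<nu> = UNIV" "space \<mu> = UNIV"
  using sets_eq_imp_space_eq[OF sets_\<nu>] sets_eq_imp_space_eq[OF sets_\<mu>] by simp_all

definition weight :: "'i \<Rightarrow> ennreal" where
  "weight j = ennreal (1 / measure \<mu> (Q j))"

lemma weight_cancel: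
  assumes "j \<in> J"
  shows "weight j * (e * emeasure \<mu> (Q j)) = e"
proof -
  have "weight j * emeasure \<mu> (Q j) = 1"
    using pos[OF assms] by (simp add: weight_def \<mu>.emeasure_eq_measure flip: ennreal_mult)
  then show ?thesis by (metis mult.left_commute mult.right_neutral)
qed

text \<open>Conditionally on the cell, the two coordinates are independent.\<close>

definition plan :: "('a \<times> 'a) measure" where
  "plan = density (\<nu> \<Otimes>\<^sub>M \<mu>) (\<lambda>z. \<Sum>j\<in>J. weight j * indicator (Q j \<times> Q j) z)"

lemma cell_rectangle [measurable]: "Q j \<times> Q j \<in> sets (\<nu> \<Otimes>\<^sub>M \<mu>)"
  by (intro pair_measureI) simp_all

text \<open>Intersecting the square of a cell with a rectangle gives a rectangle, on which the
  product measure factorises. Taking one side to be \<open>UNIV\<close> yields the two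
  marginals.\<close>

lemma emeasure_plan:
  assumes [measurable]: "A \<in> sets borel" "B \<in> sets borel"
  shows "emeasure plan (A \<times> B) = (\<Sum>j\<in>J. weight j * (emeasure \<nu> (Q j \<inter> A) * emeasure \<mu> (Q j \<inter> B)))"
proof -
  have AB [measurable]: "A \<times> B \<in> sets (\<nu> \<Otimes>\<^sub>M \<mu>)" by (intro pair_measureI) simp_all
  have "emeasure plan (A \<times> B) =
      (\<integral>\<^sup>+z. (\<Sum>j\<in>J. weight j * indicator (Q j \<times> Q j) z) * indicator (A \<times> B) z \<partial>(\<nu> \<Otimes>\<^sub>M \<mu>))"
    unfolding plan_def by (rule emeasure_density) measurable
  also have "\<dots> = (\<integral>\<^sup>+z. (\<Sum>j\<in>J. weight j * indicator ((Q j \<inter> A) \<times> (Q j \<inter> B)) z) \<partial>(\<nu> \<Otimes>\<^sub>M \<mu>))"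
    by (intro nn_integral_cong) (auto simp: sum_distrib_right indicator_def intro!: sum.cong)
  also have "\<dots> = (\<Sum>j\<in>J. weight j * emeasure (\<nu> \<Otimes>\<^sub>M \<mu>) ((Q j \<inter> A) \<times> (Q j \<inter> B)))"
  proof (subst nn_integral_sum)
    have R: "(Q j \<inter> A) \<times> (Q j \<inter> B) \<in> sets (\<nu> \<Otimes>\<^sub>M \<mu>)" for j
      by (intro pair_measureI) simp_all
    show "(\<lambda>z. weight j * indicator ((Q j \<inter> A) \<times> (Q j \<inter> B)) z) \<in> borel_measurable (\<nu> \<Otimes>\<^sub>M \<mu>)" for j
      using R by measurable
    show "(\<Sum>j\<in>J. \<integral>\<^sup>+z. weight j * indicator ((Q j \<inter> A) \<times> (Q j \<inter> B)) z \<partial>(\<nu> \<Otimes>\<^sub>M \<mu>)) =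
        (\<Sum>j\<in>J. weight j * emeasure (\<nu> \<Otimes>\<^sub>M \<mu>) ((Q j \<inter> A) \<times> (Q j \<inter> B)))"
      using R by (intro sum.cong refl nn_integral_cmult_indicator)
  qed
  also have "\<dots> = (\<Sum>j\<in>J. weight j * (emeasure \<nu> (Q j \<inter> A) * emeasure \<mu> (Q j \<inter> B)))"
    by (intro sum.cong refl arg_cong2[where f = "(*)"] \<mu>.emeasure_pair_measure_Times) simp_all
  finally show ?thesis .
qed

lemma sum_cells:
  assumes [measurable]: "A \<in> sets borel"
  shows "(\<Sum>j\<in>J. emeasure \<nu> (Q j \<inter> A)) = emeasure \<nu> A"
proof -
  have "(\<Sum>j\<in>J. emeasure \<nu> (Q j \<inter> A)) = emeasure \<nu> (\<Union>j\<in>J. Q j \<inter> A)"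
    using disjoint by (intro sum_emeasure) (auto simp: disjoint_family_on_def)
  also have "\<dots> = emeasure \<nu> A"
    using cells_\<nu> by (intro emeasure_eq_AE) auto
  finally show ?thesis .
qed

abbreviation target :: "'a measure" where
  "target \<equiv> density \<mu> (\<lambda>y. ennreal (cell_density J Q \<nu> \<mu> y))"

text \<open>The right-hand side is shaped to be \<open>emeasure_plan\<close> with first side
  \<open>UNIV\<close>, so the second marginal needs no further computation.\<close>

lemma emeasure_target:
  assumes [measurable]: "B \<in> sets borel"
  shows "emeasure target B = (\<Sum>j\<in>J. weight j * (emeasure \<nu> (Q j) * emeasure \<mu> (Q j \<inter> B)))"
proof -
  have cd: "ennreal (cell_density J Q \<nu> \<mu> y) = (\<Sum>j\<in>J. weight j * emeasure \<nu> (Q j) * indicator (Q j) y)" for y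
    unfolding cell_density_def weight_def \<nu>.emeasure_eq_measure
    by (simp add: ennreal_indicator sum_nonneg ennreal_mult[symmetric] flip: sum_ennreal ennreal_indicator)
  have "emeasure target B = (\<integral>\<^sup>+y. (\<Sum>j\<in>J. weight j * emeasure \<nu> (Q j) * indicator (Q j) y) * indicator B y \<partial>\<mu>)"
    unfolding cd by (rule emeasure_density) measurable
  also have "\<dots> = (\<integral>\<^sup>+y. (\<Sum>j\<in>J. weight j * emeasure \<nu> (Q j) * indicator (Q j \<inter> B) y) \<partial>\<mu>)"
    by (intro nn_integral_cong) (auto simp: sum_distrib_right indicator_def intro!: sum.cong)
  also have "\<dots> = (\<Sum>j\<in>J. weight j * emeasure \<nu> (Q j) * emeasure \<mu> (Q j \<inter> B))"
    by (subst nn_integral_sum) (simp_all add: nn_integral_cmult_indicator)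
  finally show ?thesis by (simp add: mult.assoc)
qed

lemma prob_space_target: "prob_space target"
proof
  have "emeasure target UNIV = (\<Sum>j\<in>J. emeasure \<nu> (Q j))"
    by (subst emeasure_target) (auto simp: weight_cancel intro!: sum.cong)
  then show "emeasure target (space target) = 1"
    using sum_cells[of UNIV] \<nu>.emeasure_space_1 by simp
qed

text \<open>In the first marginal the weight cancels the \<open>\<mu>\<close>-mass of the cell, and
  the pieces of \<open>\<nu>\<close> add up by \<open>sum_cells\<close>. The second marginal is a
  comparison of two formulas.\<close>

lemma plan_in_couplings: "plan \<in> couplings \<nu> target"
proof -
  have sp: "sets plan = sets (\<nu> \<Otimes>\<^sub>M target)"
    unfolding plan_def sets_density by (intro sets_pair_measure_cong) simp_all
  have "distr plan \<nu> fst = \<nu>"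
  proof (rule measure_eqI)
    fix A assume "A \<in> sets (distr plan \<nu> fst)"
    then have A [measurable]: "A \<in> sets borel" by simp
    have "emeasure (distr plan \<nu> fst) A = emeasure plan (A \<times> UNIV)"
      by (subst emeasure_distr)
        (auto simp: plan_def space_pair_measure intro!: arg_cong2[where f = emeasure])
    also have "\<dots> = (\<Sum>j\<in>J. emeasure \<nu> (Q j \<inter> A))"
      by (subst emeasure_plan) (auto simp: weight_cancel intro!: sum.cong)
    finally show "emeasure (distr plan \<nu> fst) A = emeasure \<nu> A"
      by (simp add: sum_cells)
  qed simp
  moreover have "distr plan target snd = target"
  proof (rule measure_eqI)
    fix A assume "A \<in> sets (distr plan target snd)"
    then have A [measurable]: "A \<in> sets borel" by simp
    have "emeasure (distr plan target snd) A = emeasure plan (UNIV \<times> A)"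
      by (subst emeasure_distr)
        (auto simp: plan_def space_pair_measure intro!: arg_cong2[where f = emeasure])
    then show "emeasure (distr plan target snd) A = emeasure target A"
      by (simp add: emeasure_plan emeasure_target)
  qed simp
  ultimately show ?thesis using sp by (simp add: couplings_def)
qed

text \<open>The density of \<open>plan\<close> vanishes off the squares
  \<open>Q j \<times> Q j\<close>, so almost every pair it couples lies in a common cell. This one
  coupling bounds the infimum.\<close>

lemma d_infty_target_le:
  assumes D: "\<And>j x y. j \<in> J \<Longrightarrow> x \<in> Q j \<Longrightarrow> y \<in> Q j \<Longrightarrow> dist x y \<le> D"
  shows "d_infty \<nu> target \<le> ennreal D"
  unfolding d_infty_def
proof (rule INF_lower2[OF plan_in_couplings], rule esssup_I)
  have [measurable_cong]: "sets plan = sets (borel \<Otimes>\<^sub>M borel)"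
    unfolding plan_def sets_density by (intro sets_pair_measure_cong) simp_all
  show "(\<lambda>(x, y). ennreal (dist x y)) \<in> borel_measurable plan" by measurable
  have "AE z in \<nu> \<Otimes>\<^sub>M \<mu>. 0 < (\<Sum>j\<in>J. weight j * indicator (Q j \<times> Q j) z) \<longrightarrow> dist (fst z) (snd z) \<le> D"
  proof (intro AE_I2 impI)
    fix z assume "0 < (\<Sum>j\<in>J. weight j * indicator (Q j \<times> Q j) z)"
    then obtain j where "j \<in> J" "z \<in> Q j \<times> Q j"
      by (metis (no_types, lifting) indicator_simps(2) mult_zero_right not_gr_zero sum.neutral)
    then show "dist (fst z) (snd z) \<le> D" using D by auto
  qed
  then show "AE z in plan. (case z of (x, y) \<Rightarrow> ennreal (dist x y)) \<le> ennreal D"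
    unfolding plan_def
    by (subst AE_density, measurable) (auto simp: case_prod_unfold elim!: eventually_mono intro: ennreal_leI)
qed

end

section \<open>Lipschitz domains and the lower bound on the mass of balls\<close>

text \<open>Moving \<open>x\<close> by \<open>s / 2\<close> along \<open>u\<close> raises it by
  \<open>s / 2\<close> relative to the graph. A further displacement of length \<open>h\<close>
  loses at most \<open>(1 + L) * h\<close> of that margin, which gives the radius. Since the radius
  is at most \<open>s / 2\<close>, the ball stays in \<open>ball x s\<close>, and
  \<open>s \<le> r / 2\<close> keeps it where the graph describes \<open>S\<close>.\<close>

lemma lipschitz_epigraph_interior_ball:
  fixes p u :: "'a::euclidean_space" and g :: "'a \<Rightarrow> real"
  assumes u: "norm u = 1" and g: "L-lipschitz_on {y. y \<bullet> u = 0} g"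
    and S: "S \<inter> ball p r = {x \<in> ball p r. g (x - (x \<bullet> u) *\<^sub>R u) < x \<bullet> u}"
    and x: "x \<in> closure S" "dist p x < r / 2" and s: "0 < s" "s \<le> r / 2"
  shows "ball (x + (s / 2) *\<^sub>R u) (s / (2 * (1 + L))) \<subseteq> S \<inter> ball x s"
proof -
  define P where "P z = z - (z \<bullet> u) *\<^sub>R u" for z
  have memS: "z \<in> S \<longleftrightarrow> g (P z) < z \<bullet> u" if "z \<in> ball p r" for z
    using that set_eq_iff[THEN iffD1, OF S, rule_format, of z] by (simp add: P_def)
  have uu: "u \<bullet> u = 1" using u by (simp add: norm_eq_1)
  have L: "0 \<le> L" using g by (rule lipschitz_on_nonneg)
  have P0: "P z \<bullet> u = 0" for z by (simp add: P_def uu inner_diff_left)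
  \<comment> \<open>\<open>P\<close> is an orthogonal projection, so by Pythagoras it does not
    increase distances.\<close>
  have Pdiff: "norm (P z - P w) \<le> norm (z - w)" for z w
  proof -
    have eq: "P z - P w = (z - w) - ((z - w) \<bullet> u) *\<^sub>R u" by (simp add: P_def algebra_simps inner_diff_left)
    have "(norm (P z - P w))\<^sup>2 = (norm (z - w))\<^sup>2 - ((z - w) \<bullet> u)\<^sup>2"
      unfolding eq power2_norm_eq_inner
      by (simp add: inner_diff_left inner_diff_right uu inner_commute power2_eq_square algebra_simps)
    then have "(norm (P z - P w))\<^sup>2 \<le> (norm (z - w))\<^sup>2" by simp
    then show ?thesis by (rule power2_le_imp_le) simp
  qed
  have gP: "\<bar>g (P z) - g (P w)\<bar> \<le> L * norm (z - w)" for z w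
  proof -
    have "\<bar>g (P z) - g (P w)\<bar> \<le> L * norm (P z - P w)"
      using lipschitz_onD[OF g, of "P z" "P w"] P0 by (simp add: dist_norm)
    also have "\<dots> \<le> L * norm (z - w)" by (rule mult_left_mono[OF Pdiff L])
    finally show ?thesis .
  qed
  have height: "\<bar>z \<bullet> u - w \<bullet> u\<bar> \<le> norm (z - w)" for z w
    using Cauchy_Schwarz_ineq2[of "z - w" u] u by (simp add: inner_diff_left)
  \<comment> \<open>Points of the closure satisfy only the weak inequality, obtained by
    approximation from \<open>S\<close>. The cap \<open>r / 2\<close> in \<open>e'\<close> keeps the
    approximating point inside \<open>ball p r\<close>.\<close>
  have gx: "g (P x) \<le> x \<bullet> u"
  proof (rule field_le_epsilon)
    fix e :: real assume e: "0 < e"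
    define e' where "e' = min (e / (1 + L)) (r / 2)"
    have e': "0 < e'" "(1 + L) * e' \<le> e"
      using e s L mult_left_mono[of e' "e / (1 + L)" "1 + L"] by (auto simp: e'_def)
    obtain w where w: "w \<in> S" "dist w x < e'"
      using x(1) e'(1) by (auto simp: closure_approachable)
    have "dist p w < r" using dist_triangle[of p w x] x(2) w(2) by (simp add: e'_def dist_commute)
    then have "g (P w) < w \<bullet> u" using memS w(1) by simp
    moreover have "g (P x) \<le> g (P w) + L * norm (x - w)" using gP[of x w] by linarith
    moreover have "w \<bullet> u \<le> x \<bullet> u + norm (x - w)" using height[of x w] by linarith
    moreover have "(1 + L) * norm (x - w) \<le> (1 + L) * e'"
      using w(2) L by (intro mult_left_mono) (auto simp: dist_norm norm_minus_commute)
    ultimately show "g (P x) \<le> x \<bullet> u + e" using e'(2) by (simp add: algebra_simps)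
  qed
  show ?thesis
  proof
    fix z assume "z \<in> ball (x + (s / 2) *\<^sub>R u) (s / (2 * (1 + L)))"
    define q where "q = x + (s / 2) *\<^sub>R u"
    have zq: "norm (z - q) < s / (2 * (1 + L))"
      using \<open>z \<in> _\<close> by (simp add: q_def dist_norm norm_minus_commute)
    also have "\<dots> \<le> s / 2" using L s by (simp add: field_simps)
    finally have zq2: "norm (z - q) < s / 2" .
    have "norm (z - x) \<le> norm (z - q) + norm (q - x)" by norm
    also have "norm (q - x) = s / 2" using s u by (simp add: q_def)
    finally have zx: "norm (z - x) < s" using zq2 by simp
    then have zr: "z \<in> ball p r"
      using dist_triangle[of p z x] x(2) s(2) by (simp add: dist_norm norm_minus_commute)
    have "P q = P x" by (simp add: P_def q_def inner_add_left uu algebra_simps)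
    then have "g (P z) \<le> g (P x) + L * norm (z - q)" using gP[of z q] by simp
    also have "\<dots> \<le> x \<bullet> u + L * norm (z - q)" using gx by simp
    also have "x \<bullet> u = q \<bullet> u - s / 2" by (simp add: q_def inner_add_left uu)
    also have "q \<bullet> u - s / 2 + L * norm (z - q) \<le> z \<bullet> u - s / 2 + (1 + L) * norm (z - q)"
      using height[of z q] by (simp add: algebra_simps)
    also have "(1 + L) * norm (z - q) < s / 2"
      using zq L by (simp add: field_simps)
    finally have "g (P z) < z \<bullet> u" by simp
    then have "z \<in> S" using memS zr by simp
    then show "z \<in> S \<inter> ball x s" using zx by (simp add: dist_norm norm_minus_commute)
  qed
qed

text \<open>This is the interior corkscrew condition up to scale \<open>r\<close>. Centres are
  restricted to a set \<open>T\<close> so that constants found locally can be glued.\<close>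

definition contains_balls :: "'a::metric_space set \<Rightarrow> 'a set \<Rightarrow> real \<Rightarrow> real \<Rightarrow> bool" where
  "contains_balls S T k r \<longleftrightarrow> (\<forall>x\<in>T. \<forall>s. 0 < s \<and> s \<le> r \<longrightarrow> (\<exists>z. ball z (k * s) \<subseteq> S \<inter> ball x s))"

text \<open>Around a point of \<open>S\<close> small balls lie in \<open>S\<close> themselves;
  around a boundary point the epigraph lemma applies. Compactness of the closure leaves finitely
  many local constants.\<close>

lemma lipschitz_domain_contains_balls:
  fixes S :: "'a::euclidean_space set"
  assumes "open S" "bounded S" "lipschitz_boundary S"
  obtains k r where "0 < k" "0 < r" "contains_balls S (closure S) k r"
proof -
  have local: "\<exists>k r. 0 < k \<and> 0 < r \<and> contains_balls S (closure S \<inter> ball p r) k r" if p: "p \<in> closure S" for p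
  proof (cases "p \<in> S")
    case True
    then obtain e where e: "0 < e" "ball p e \<subseteq> S" using assms(1) openE by blast
    have "ball x (1 * s) \<subseteq> S \<inter> ball x s" if "x \<in> ball p (e / 2)" "s \<le> e / 2" for x s
    proof -
      have "ball x s \<subseteq> ball p e"
        using that by (intro ball_subset_ball_iff[THEN iffD2]) (auto simp: dist_commute)
      then show ?thesis using e by auto
    qed
    then have "contains_balls S (closure S \<inter> ball p (e / 2)) 1 (e / 2)"
      unfolding contains_balls_def by blast
    then show ?thesis using e by (intro exI[of _ 1] exI[of _ "e / 2"]) auto
  next
    case False
    then have "p \<in> frontier S" using p assms(1) by (simp add: frontier_def interior_open)
    with assms(3) have "\<exists>r>0. \<exists>u g L. norm u = 1 \<and> L-lipschitz_on {y. y \<bullet> u = 0} (g :: 'a \<Rightarrow> real) \<and>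
        S \<inter> ball p r = {x \<in> ball p r. g (x - (x \<bullet> u) *\<^sub>R u) < x \<bullet> u}"
      unfolding lipschitz_boundary_def by (rule bspec)
    then obtain r u g L where r: "r > 0" and u: "norm u = 1"
      and g: "L-lipschitz_on {y. y \<bullet> u = 0} (g :: 'a \<Rightarrow> real)"
      and S: "S \<inter> ball p r = {x \<in> ball p r. g (x - (x \<bullet> u) *\<^sub>R u) < x \<bullet> u}"
      by (elim exE conjE)
    have "0 \<le> L" using g by (rule lipschitz_on_nonneg)
    moreover have "contains_balls S (closure S \<inter> ball p (r / 2)) (1 / (2 * (1 + L))) (r / 2)"
      unfolding contains_balls_def
    proof (intro ballI allI impI)
      fix x s assume "x \<in> closure S \<inter> ball p (r / 2)" "0 < s \<and> s \<le> r / 2"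
      then show "\<exists>z. ball z (1 / (2 * (1 + L)) * s) \<subseteq> S \<inter> ball x s"
        using lipschitz_epigraph_interior_ball[OF u g S, of x s] by auto
    qed
    ultimately show ?thesis using r by (intro exI[of _ "1 / (2 * (1 + L))"] exI[of _ "r / 2"]) auto
  qed
  then have "\<forall>p\<in>closure S. \<exists>k r. 0 < k \<and> 0 < r \<and> contains_balls S (closure S \<inter> ball p r) k r" by blast
  from bchoice[OF this] obtain k
    where "\<forall>p\<in>closure S. \<exists>r. 0 < k p \<and> 0 < r \<and> contains_balls S (closure S \<inter> ball p r) (k p) r" by blast
  from bchoice[OF this] obtain r
    where kr: "\<And>p. p \<in> closure S \<Longrightarrow> 0 < k p \<and> 0 < r p \<and> contains_balls S (closure S \<inter> ball p (r p)) (k p) (r p)"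
    by blast
  have "compact (closure S)" using assms(2) by simp
  then obtain F where F: "F \<subseteq> closure S" "finite F" "closure S \<subseteq> (\<Union>p\<in>F. ball p (r p))"
    by (rule compactE_image[of _ "closure S" "\<lambda>p. ball p (r p)"]) (use kr in auto)
  \<comment> \<open>Inserting 1 keeps the minima meaningful when \<open>F\<close> is empty.\<close>
  define k0 r0 where "k0 = Min (insert 1 (k ` F))" and "r0 = Min (insert 1 (r ` F))"
  have "0 < k0" "0 < r0" using F kr by (auto simp: k0_def r0_def)
  moreover have "contains_balls S (closure S) k0 r0"
    unfolding contains_balls_def
  proof (intro ballI allI impI)
    fix x s assume x: "x \<in> closure S" and s: "0 < s \<and> s \<le> r0"
    then obtain p where p: "p \<in> F" "x \<in> ball p (r p)" using F by blast
    have le: "k0 \<le> k p" "r0 \<le> r p" using p F(2) by (auto simp: k0_def r0_def)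
    have "contains_balls S (closure S \<inter> ball p (r p)) (k p) (r p)" using kr p F by auto
    moreover have "x \<in> closure S \<inter> ball p (r p)" "0 < s \<and> s \<le> r p" using x p s le by auto
    ultimately obtain z where "ball z (k p * s) \<subseteq> S \<inter> ball x s"
      unfolding contains_balls_def by blast
    moreover have "ball z (k0 * s) \<subseteq> ball z (k p * s)"
      using le s by (intro subset_ball mult_right_mono) auto
    ultimately show "\<exists>z. ball z (k0 * s) \<subseteq> S \<inter> ball x s" by blast
  qed
  ultimately show ?thesis using that by blast
qed

text \<open>The ball of radius \<open>k * s\<close> inside \<open>\<Omega>\<close> has volume
  proportional to \<open>s ^ DIM('a)\<close>, and the density is at least \<open>c\<close>
  there.\<close>

lemma lower_regular_density:
  fixes \<Omega> :: "'a::euclidean_space set" and \<rho> :: "'a \<Rightarrow> real"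
  assumes Omega: "open \<Omega>" "bounded \<Omega>" "lipschitz_boundary \<Omega>"
    and mu: "prob_space \<mu>" "\<mu> = density lborel (\<lambda>x. ennreal (indicator (closure \<Omega>) x * \<rho> x))"
    and rho: "continuous_on (closure \<Omega>) \<rho>" "0 < c" "\<And>x. x \<in> closure \<Omega> \<Longrightarrow> c \<le> \<rho> x"
  obtains \<kappa> r where "0 < \<kappa>" "0 < r"
    "\<And>x s. x \<in> closure \<Omega> \<Longrightarrow> 0 < s \<Longrightarrow> s \<le> r \<Longrightarrow> \<kappa> * s ^ DIM('a) \<le> measure \<mu> (ball x s)"
proof -
  interpret prob_space \<mu> by fact
  obtain k r where kr: "0 < k" "0 < r" "contains_balls \<Omega> (closure \<Omega>) k r"
    using lipschitz_domain_contains_balls[OF Omega] .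
  define \<kappa> where "\<kappa> = c * unit_ball_vol (DIM('a)) * k ^ DIM('a)"
  have [measurable]: "(\<lambda>x. indicator (closure \<Omega>) x * \<rho> x) \<in> borel_measurable borel"
    using borel_measurable_continuous_on_indicator[OF _ rho(1)] by simp
  have "\<kappa> * s ^ DIM('a) \<le> measure \<mu> (ball x s)" if x: "x \<in> closure \<Omega>" and s: "0 < s" "s \<le> r" for x s
  proof -
    obtain z where z: "ball z (k * s) \<subseteq> \<Omega> \<inter> ball x s"
      using kr(3) x s unfolding contains_balls_def by blast
    have "ennreal (\<kappa> * s ^ DIM('a)) = ennreal c * emeasure lborel (ball z (k * s))"
      using s kr rho(2) by (simp add: emeasure_ball \<kappa>_def power_mult_distrib mult.assoc flip: ennreal_mult)
    also have "\<dots> = (\<integral>\<^sup>+y. ennreal c * indicator (ball z (k * s)) y \<partial>lborel)"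
      by (simp add: nn_integral_cmult_indicator)
    also have "\<dots> \<le> (\<integral>\<^sup>+y. ennreal (indicator (closure \<Omega>) y * \<rho> y) * indicator (ball x s) y \<partial>lborel)"
    proof (intro nn_integral_mono)
      fix y
      show "ennreal c * indicator (ball z (k * s)) y \<le> ennreal (indicator (closure \<Omega>) y * \<rho> y) * indicator (ball x s) y"
      proof (cases "y \<in> ball z (k * s)")
        case True
        then have "y \<in> ball x s" "y \<in> closure \<Omega>" using z closure_subset[of \<Omega>] by auto
        then show ?thesis using True rho(3)[of y] by (simp add: ennreal_leI)
      qed simp
    qed
    also have "\<dots> = emeasure \<mu> (ball x s)"
      unfolding mu(2) by (subst emeasure_density) simp_all
    finally show ?thesis by (simp add: emeasure_eq_measure)
  qed
  moreover have "0 < \<kappa>" using kr rho(2) by (simp add: \<kappa>_def)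
  ultimately show ?thesis using that kr(2) by blast
qed

section \<open>Almost sure convergence of the empirical cell ratios\<close>

lemma AE_empirical_measure:
  assumes "n \<ge> 1" and [measurable]: "A \<in> sets borel" and "\<And>i. i \<in> {1..n} \<Longrightarrow> x i \<in> A"
  shows "AE y in empirical_measure n x. y \<in> A"
  unfolding empirical_measure_eq_distr[OF assms(1)]
  by (subst AE_distr_iff) (use assms in \<open>auto simp: AE_measure_pmf_iff\<close>)

text \<open>\<open>t n\<close> bounds the expected number of points per cell from below. As it
  dominates \<open>ln n\<close>, the Chernoff bound makes each cell fail with probability at most
  \<open>2 / n ^ 3\<close>. There are eventually at most \<open>n\<close> cells, so the failure
  probabilities are summable and Borel-Cantelli applies.\<close>

lemma (in prob_space) empirical_cells_converge:
  fixes X :: "nat \<Rightarrow> 'a \<Rightarrow> 'b::topological_space" and \<mu> :: "'b measure"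
    and Q :: "nat \<Rightarrow> 'i \<Rightarrow> 'b set" and t :: "nat \<Rightarrow> real"
  assumes ind: "indep_vars (\<lambda>_. borel) X {1..}" and distr: "\<And>i. i \<ge> 1 \<Longrightarrow> distr M borel (X i) = \<mu>"
    and J: "\<And>n. finite (J n)" and Q [measurable]: "\<And>n j. Q n j \<in> sets borel"
    and disj: "\<And>n. disjoint_family_on (Q n) (J n)"
    and t: "filterlim (\<lambda>n. t n / ln (real n)) at_top sequentially"
    and lower: "\<forall>\<^sub>F n in sequentially. \<forall>j\<in>J n. t n \<le> real n * measure \<mu> (Q n j)"
  shows "AE \<omega> in M. \<forall>\<eta>>0. \<forall>\<^sub>F n in sequentially. \<forall>j\<in>J n.
           \<bar>measure (empirical_measure n (\<lambda>i. X i \<omega>)) (Q n j) / measure \<mu> (Q n j) - 1\<bar> < \<eta>"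
proof -
  have X [measurable]: "X i \<in> borel_measurable M" if "i \<ge> 1" for i
    using ind that by (auto simp: indep_vars_def)
  have mu: "\<mu> = distr M borel (X 1)" by (simp add: distr)
  interpret \<mu>: prob_space \<mu> unfolding mu by (rule prob_space_distr) simp
  have sets_mu [measurable_cong, simp]: "sets \<mu> = sets borel" by (simp add: mu)
  define S where "S n j \<omega> = (\<Sum>i\<in>{1..n}. indicator (Q n j) (X i \<omega>) :: real)" for n j \<omega>
  have [measurable]: "S n j \<in> borel_measurable M" for n j unfolding S_def by measurable
  define p where "p n j = measure \<mu> (Q n j)" for n j
  have hit: "prob {\<omega> \<in> space M. X i \<omega> \<in> Q n j} = p n j" if "i \<in> {1..n}" for i n j
  proof -
    have "p n j = measure (distr M borel (X i)) (Q n j)"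
      using distr that by (simp add: p_def)
    then show ?thesis
      using that by (simp add: measure_distr vimage_def Int_def conj_commute)
  qed
  have p0: "0 \<le> p n j" for n j by (simp add: p_def)
  \<comment> \<open>From \<open>n = 3\<close> on, because \<open>exp 1 \<le> 3\<close>. Together
    with \<open>t1[of 1]\<close> this gives \<open>1 \<le> t n\<close>.\<close>
  have ln_ge_1: "\<forall>\<^sub>F n in sequentially. 1 \<le> ln (real n)"
    using eventually_ge_at_top[of 3]
  proof eventually_elim
    case (elim n)
    then show ?case using exp_le by (subst ln_ge_iff) auto
  qed
  have t1: "\<forall>\<^sub>F n in sequentially. b * ln (real n) \<le> t n" for b
  proof -
    have "\<forall>\<^sub>F n in sequentially. b \<le> t n / ln (real n)" using t by (simp add: filterlim_at_top)
    with eventually_gt_at_top[of 1] show ?thesis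
      by eventually_elim (simp add: field_simps)
  qed
  have main: "AE \<omega> in M. \<forall>\<^sub>F n in sequentially. \<forall>j\<in>J n. \<bar>S n j \<omega> - n * p n j\<bar> < \<eta> * (n * p n j)"
    if \<eta>: "0 < \<eta>" "\<eta> \<le> 1" for \<eta> :: real
  proof -
    define A where "A n = (\<Union>j\<in>J n. {\<omega> \<in> space M. \<eta> * (n * p n j) \<le> \<bar>S n j \<omega> - n * p n j\<bar>})" for n
    have A [measurable]: "A n \<in> sets M" for n
      unfolding A_def using J[of n] by (intro sets.finite_UN) measurable
    from ln_ge_1 have "\<forall>\<^sub>F n in sequentially. prob (A n) \<le> 2 * (1 / real n ^ 2)"
      \<comment> \<open>The factor \<open>12 / \<eta>\<^sup>2\<close> is what turns the Chernoff
        exponent into at least \<open>3 * ln n\<close>: one power of \<open>n\<close> pays for the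
        number of cells, two remain for summability.\<close>
      using t1[of "12 / \<eta>\<^sup>2"] t1[of 1] lower eventually_gt_at_top[of 0]
    proof eventually_elim
      case (elim n)
      have t_pos: "1 \<le> t n" using elim by simp
      \<comment> \<open>The cells are disjoint and each has \<open>\<mu>\<close>-mass at least
        \<open>t n / n\<close>; total mass 1 then limits their number.\<close>
      have "real (card (J n)) * t n \<le> (\<Sum>j\<in>J n. real n * p n j)"
        using elim(4) by (intro sum_bounded_below[of "J n" "t n", simplified]) (auto simp: p_def)
      also have "\<dots> = real n * measure \<mu> (\<Union>j\<in>J n. Q n j)"
        unfolding p_def sum_distrib_left[symmetric]
        by (subst \<mu>.finite_measure_finite_Union) (use J disj in auto)
      also have "\<dots> \<le> real n" by (simp add: mult_left_le)
      finally have card: "real (card (J n)) \<le> real n"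
        using mult_left_mono[OF t_pos, of "real (card (J n))"] by simp
      have "prob (A n) \<le> (\<Sum>j\<in>J n. prob {\<omega> \<in> space M. \<eta> * (n * p n j) \<le> \<bar>S n j \<omega> - n * p n j\<bar>})"
        unfolding A_def using J by (intro measure_UNION_le) auto
      also have "\<dots> \<le> (\<Sum>j\<in>J n. 2 * exp (- (3 * ln (real n))))"
      proof (rule sum_mono)
        fix j assume j: "j \<in> J n"
        have "prob {\<omega> \<in> space M. \<eta> * (n * p n j) \<le> \<bar>S n j \<omega> - n * p n j\<bar>} \<le> 2 * exp (- (n * p n j * \<eta>\<^sup>2 / 4))"
          unfolding S_def
          using multiplicative_Chernoff[OF finite_atLeastAtMost indep_vars_subset[OF ind], of 1 n "Q n j" "p n j" \<eta>]
            hit p0 \<eta> by auto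
        also have "12 / \<eta>\<^sup>2 * ln (real n) \<le> n * p n j" using elim j by (auto simp: p_def)
        then have "3 * ln (real n) \<le> n * p n j * \<eta>\<^sup>2 / 4" using \<eta> by (simp add: field_simps)
        then have "2 * exp (- (n * p n j * \<eta>\<^sup>2 / 4)) \<le> 2 * exp (- (3 * ln (real n)))" by simp
        finally show "prob {\<omega> \<in> space M. \<eta> * (n * p n j) \<le> \<bar>S n j \<omega> - n * p n j\<bar>} \<le> 2 * exp (- (3 * ln (real n)))" .
      qed
      also have "exp (- (3 * ln (real n))) = 1 / real n ^ 3"
        using elim by (simp add: exp_minus exp_of_nat_mult[of 3, simplified] inverse_eq_divide)
      also have "(\<Sum>j\<in>J n. 2 * (1 / real n ^ 3)) \<le> real n * (2 * (1 / real n ^ 3))"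
        using card by (simp add: mult_right_mono divide_right_mono)
      also have "\<dots> = 2 * (1 / real n ^ 2)" using elim by (simp add: power2_eq_square power3_eq_cube)
      finally show ?case .
    qed
    moreover have "summable (\<lambda>n. 2 * (1 / real n ^ 2))"
      using inverse_power_summable[of 2, where 'a = real] by (intro summable_mult) (simp add: inverse_eq_divide)
    ultimately have "summable (\<lambda>n. prob (A n))"
      by (intro summable_comparison_test_ev[of "\<lambda>n. prob (A n)"]) auto
    then have "AE \<omega> in M. \<forall>\<^sub>F n in sequentially. \<omega> \<in> space M - A n"
      by (intro borel_cantelli_AE1) (auto simp: emeasure_eq_measure)
    then show ?thesis
      by (rule eventually_mono) (auto simp: A_def not_le elim!: eventually_mono)
  qed
  \<comment> \<open>Only countably many tolerances are used, so that the exceptional null sets can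
    be united before \<open>\<eta>\<close> is chosen.\<close>
  have "AE \<omega> in M. \<forall>k. \<forall>\<^sub>F n in sequentially. \<forall>j\<in>J n. \<bar>S n j \<omega> - n * p n j\<bar> < 1 / Suc k * (n * p n j)"
    unfolding AE_all_countable by (intro allI main) auto
  then show ?thesis
  proof (rule eventually_mono, intro allI impI)
    fix \<omega> and \<eta> :: real
    assume *: "\<forall>k. \<forall>\<^sub>F n in sequentially. \<forall>j\<in>J n. \<bar>S n j \<omega> - n * p n j\<bar> < 1 / Suc k * (n * p n j)" and "0 < \<eta>"
    then obtain k where k: "1 / Suc k < \<eta>" by (metis nat_approx_posE)
    from ln_ge_1 show "\<forall>\<^sub>F n in sequentially. \<forall>j\<in>J n.
        \<bar>measure (empirical_measure n (\<lambda>i. X i \<omega>)) (Q n j) / measure \<mu> (Q n j) - 1\<bar> < \<eta>"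
      using *[rule_format, of k] lower t1[of 1] eventually_gt_at_top[of 0]
    proof eventually_elim
      case (elim n)
      show ?case
      proof
        fix j assume j: "j \<in> J n"
        have "0 < real n * p n j" using elim j by (fastforce simp: p_def)
        then have pos: "0 < p n j" using elim by (simp add: zero_less_mult_iff)
        have "\<bar>S n j \<omega> - n * p n j\<bar> < 1 / Suc k * (n * p n j)" using elim j by auto
        also have "\<dots> < \<eta> * (n * p n j)" using k \<open>0 < real n * p n j\<close> by (rule mult_strict_right_mono)
        finally have "\<bar>S n j \<omega> - n * p n j\<bar> / (n * p n j) < \<eta>"
          using \<open>0 < real n * p n j\<close> by (simp add: divide_less_eq)
        also have "\<bar>S n j \<omega> - n * p n j\<bar> / (n * p n j) = \<bar>(S n j \<omega> - n * p n j) / (n * p n j)\<bar>"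
          using \<open>0 < real n * p n j\<close> by simp
        also have "(S n j \<omega> - n * p n j) / (n * p n j) = S n j \<omega> / n / p n j - 1"
          using pos elim by (simp add: field_simps)
        finally show "\<bar>measure (empirical_measure n (\<lambda>i. X i \<omega>)) (Q n j) / measure \<mu> (Q n j) - 1\<bar> < \<eta>"
          using elim by (simp add: measure_empirical_measure S_def p_def)
      qed
    qed
  qed
qed

section \<open>Construction of the approximating measures\<close>

text \<open>The geometry enters only through compactness of \<open>K\<close> and the lower mass
  bound with exponent \<open>d\<close>; \<open>\<delta>\<close> is the cell scale, small against
  \<open>\<epsilon>\<close> yet large enough for concentration in every cell.\<close>

lemma (in prob_space) empirical_measure_cell_approximation:
  fixes X :: "nat \<Rightarrow> 'a \<Rightarrow> 'b::{second_countable_topology, metric_space}" and \<mu> :: "'b measure"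
    and \<delta> \<epsilon> :: "nat \<Rightarrow> real" and d :: nat
  assumes ind: "indep_vars (\<lambda>_. borel) X {1..}" and distr: "\<And>i. i \<ge> 1 \<Longrightarrow> distr M borel (X i) = \<mu>"
    and K: "compact K" "AE x in \<mu>. x \<in> K"
    and regular: "0 < \<kappa>" "0 < r" "\<And>x s. x \<in> K \<Longrightarrow> 0 < s \<Longrightarrow> s \<le> r \<Longrightarrow> \<kappa> * s ^ d \<le> measure \<mu> (ball x s)"
    and \<delta>: "\<forall>\<^sub>F n in sequentially. 0 < \<delta> n" "\<delta> \<longlonglongrightarrow> 0"
      "filterlim (\<lambda>n. real n * \<delta> n ^ d / ln (real n)) at_top sequentially"
    and \<epsilon>: "\<And>n. n \<ge> 1 \<Longrightarrow> 0 < \<epsilon> n" "(\<lambda>n. \<delta> n / \<epsilon> n) \<longlonglongrightarrow> 0"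
  shows "\<exists>\<mu>t :: nat \<Rightarrow> 'a \<Rightarrow> 'b measure.
    (\<forall>n\<ge>1. \<mu>t n \<in> M \<rightarrow>\<^sub>M prob_algebra borel) \<and>
    (\<forall>n\<ge>1. \<forall>\<omega>\<in>space M. absolutely_continuous \<mu> (\<mu>t n \<omega>)) \<and>
    (AE \<omega> in M. (\<lambda>n. d_infty (empirical_measure n (\<lambda>i. X i \<omega>)) (\<mu>t n \<omega>) / ennreal (\<epsilon> n)) \<longlonglongrightarrow> 0) \<and>
    (AE \<omega> in M. \<exists>f :: nat \<Rightarrow> 'b \<Rightarrow> real.
       (\<forall>n\<ge>1. RN_version \<mu> (\<mu>t n \<omega>) (f n)) \<and> uniform_limit K f (\<lambda>_. 1) sequentially)"
proof -
  have X [measurable]: "X i \<in> borel_measurable M" if "i \<ge> 1" for i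
    using ind that by (auto simp: indep_vars_def)
  have mu: "\<mu> = distr M borel (X 1)" by (simp add: distr)
  interpret \<mu>: prob_space \<mu> unfolding mu by (rule prob_space_distr) simp
  have sets_mu [measurable_cong, simp]: "sets \<mu> = sets borel" by (simp add: mu)
  have [simp]: "space \<mu> = UNIV" by (simp add: mu)
  have K_borel [measurable]: "K \<in> sets borel" using K(1) by (simp add: compact_imp_closed)
  \<comment> \<open>The upper bound says \<open>\<delta> n / 2 \<le> r\<close>, so that the lower
    mass bound applies to the inner ball of each cell.\<close>
  define good where "good n \<longleftrightarrow> 0 < \<delta> n \<and> \<delta> n \<le> 2 * r" for n
  have good: "\<forall>\<^sub>F n in sequentially. good n"
  proof -
    have "\<forall>\<^sub>F n in sequentially. \<delta> n < 2 * r" using \<delta>(2) regular(2) by (intro order_tendstoD) auto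
    with \<delta>(1) show ?thesis by eventually_elim (simp add: good_def)
  qed
  \<comment> \<open>Covering, mass and diameter are required only for good \<open>n\<close>. For the
    other \<open>n\<close> the empty partition qualifies, so cells can be chosen for all
    \<open>n\<close> at once.\<close>
  define cells where "cells n m Q \<longleftrightarrow> (\<forall>j. Q j \<in> sets borel) \<and> disjoint_family_on Q {..<m} \<and>
      (good n \<longrightarrow> K \<subseteq> (\<Union>j<m. Q j) \<and>
        (\<forall>j<m. \<kappa> * (\<delta> n / 2) ^ d \<le> measure \<mu> (Q j) \<and> (\<forall>x\<in>Q j. \<forall>y\<in>Q j. dist x y \<le> 4 * \<delta> n)))"
    for n m :: nat and Q :: "nat \<Rightarrow> 'b set"
  have "\<exists>m Q. cells n m Q" for n
  proof (cases "good n")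
    case True
    then have \<delta>n: "0 < \<delta> n" "\<delta> n / 2 \<le> r" by (auto simp: good_def)
    obtain m y Q where Q: "\<And>j. j < m \<Longrightarrow> y j \<in> K" "\<And>j. Q j \<in> sets borel"
      "\<And>j. j < m \<Longrightarrow> ball (y j) (\<delta> n / 2) \<subseteq> Q j" "\<And>j. j < m \<Longrightarrow> Q j \<subseteq> ball (y j) (2 * \<delta> n)"
      "disjoint_family_on Q {..<m::nat}" "K \<subseteq> (\<Union>j<m. Q j)"
      by (rule compact_cell_partition[OF K(1) \<delta>n(1)]) blast
    have "\<kappa> * (\<delta> n / 2) ^ d \<le> measure \<mu> (Q j)" if "j < m" for j
    proof -
      have "\<kappa> * (\<delta> n / 2) ^ d \<le> measure \<mu> (ball (y j) (\<delta> n / 2))"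
        using that \<delta>n Q(1) by (intro regular(3)) auto
      also have "\<dots> \<le> measure \<mu> (Q j)" using that Q by (intro \<mu>.finite_measure_mono) auto
      finally show ?thesis .
    qed
    moreover have "dist x z \<le> 4 * \<delta> n" if "j < m" "x \<in> Q j" "z \<in> Q j" for j x z
    proof -
      have "dist (y j) x < 2 * \<delta> n" "dist (y j) z < 2 * \<delta> n" using Q(4)[OF that(1)] that(2,3) by auto
      then show ?thesis using dist_triangle3[of x z "y j"] by simp
    qed
    ultimately have "cells n m Q" using Q by (auto simp: cells_def)
    then show ?thesis by blast
  next
    case False
    then have "cells n 0 (\<lambda>_. {})" by (simp add: cells_def disjoint_family_on_def)
    then show ?thesis by blast
  qed
  then have "\<forall>n. \<exists>m Q. cells n m Q" by blast
  \<comment> \<open>The partitions are fixed before \<open>\<omega>\<close> appears; only the cell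
    counts are random.\<close>
  from choice[OF this] obtain m where "\<forall>n. \<exists>Q. cells n (m n) Q" by blast
  from choice[OF this] obtain Q where Q_cells: "\<And>n. cells n (m n) (Q n)" by blast
  have Q_borel [measurable]: "Q n j \<in> sets borel"
    and disj: "disjoint_family_on (Q n) {..<m n}" for n j
    using Q_cells[of n] by (simp_all add: cells_def)
  have Q: "K \<subseteq> (\<Union>j<m n. Q n j)"
      "j < m n \<Longrightarrow> \<kappa> * (\<delta> n / 2) ^ d \<le> measure \<mu> (Q n j)"
      "j < m n \<Longrightarrow> x \<in> Q n j \<Longrightarrow> y \<in> Q n j \<Longrightarrow> dist x y \<le> 4 * \<delta> n"
    if "good n" for n j x y
    using Q_cells[of n] that by (auto simp: cells_def)
  define \<nu> where "\<nu> n \<omega> = empirical_measure n (\<lambda>i. X i \<omega>)" for n \<omega>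
  define ok where "ok n \<omega> \<longleftrightarrow> good n \<and> (\<forall>i\<in>{1..n}. X i \<omega> \<in> K)" for n \<omega>
  \<comment> \<open>Off \<open>ok\<close> the sample may miss every cell, so the cell density need not integrate to 1.\<close>
  define f where "f n \<omega> y = (if ok n \<omega> then cell_density {..<m n} (Q n) (\<nu> n \<omega>) \<mu> y else 1)" for n \<omega> y
  define \<mu>t where "\<mu>t n \<omega> = density \<mu> (\<lambda>y. ennreal (f n \<omega> y))" for n \<omega>
  have transport: "cell_transport (\<nu> n \<omega>) \<mu> {..<m n} (Q n)" if n: "n \<ge> 1" and ok: "ok n \<omega>" for n \<omega>
  proof -
    interpret \<nu>: prob_space "\<nu> n \<omega>" unfolding \<nu>_def by (rule prob_space_empirical_measure[OF n])
    have g: "good n" using ok by (simp add: ok_def)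
    show ?thesis
    proof
      show "AE x in \<nu> n \<omega>. x \<in> (\<Union>j\<in>{..<m n}. Q n j)"
        unfolding \<nu>_def
      proof (rule AE_empirical_measure[OF n])
        show "X i \<omega> \<in> (\<Union>j\<in>{..<m n}. Q n j)" if "i \<in> {1..n}" for i
          using ok Q(1)[OF g] that unfolding ok_def by blast
      qed measurable
      show "0 < measure \<mu> (Q n j)" if "j \<in> {..<m n}" for j
      proof -
        have "0 < \<kappa> * (\<delta> n / 2) ^ d" using g regular(1) by (simp add: good_def)
        also have "\<dots> \<le> measure \<mu> (Q n j)" using Q(2) g that by simp
        finally show ?thesis .
      qed
    qed (auto simp: \<nu>_def disj)
  qed
  have f_meas [measurable]: "f n \<omega> \<in> borel_measurable borel" for n \<omega>
    unfolding f_def[abs_def] cell_density_def by measurable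
  have \<mu>t_ok: "\<mu>t n \<omega> = density \<mu> (\<lambda>y. ennreal (cell_density {..<m n} (Q n) (\<nu> n \<omega>) \<mu> y))" if "ok n \<omega>" for n \<omega>
    using that by (simp add: \<mu>t_def f_def)
  have \<mu>t_not_ok: "\<mu>t n \<omega> = \<mu>" if "\<not> ok n \<omega>" for n \<omega>
    using that by (simp add: \<mu>t_def f_def density_1)
  have prob: "prob_space (\<mu>t n \<omega>)" if "n \<ge> 1" for n \<omega>
    using cell_transport.prob_space_target[OF transport[OF that]] \<mu>t_ok \<mu>t_not_ok \<mu>.prob_space_axioms
    by (cases "ok n \<omega>") auto
  have "\<mu>t n \<in> M \<rightarrow>\<^sub>M prob_algebra borel" if n: "n \<ge> 1" for n
  proof (intro measurable_prob_algebraI measurable_subprob_algebra)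
    show "prob_space (\<mu>t n \<omega>)" "subprob_space (\<mu>t n \<omega>)" for \<omega>
      using prob[OF n] by (auto intro: prob_space_imp_subprob_space)
    show "sets (\<mu>t n \<omega>) = sets borel" for \<omega> by (simp add: \<mu>t_def)
    fix A :: "'b set" assume A [measurable]: "A \<in> sets borel"
    have [measurable]: "Measurable.pred M (ok n)"
      unfolding ok_def[abs_def] by measurable
    \<comment> \<open>For a fixed set \<open>A\<close>, randomness enters only through
      \<open>ok\<close> and the events that a sample point hits a cell, so measurability in
      \<open>\<omega>\<close> is visible from the formula.\<close>
    have "emeasure (\<mu>t n \<omega>) A = (if ok n \<omega> then
        \<Sum>j\<in>{..<m n}. ennreal (1 / measure \<mu> (Q n j)) * ((\<Sum>i=1..n. indicator (Q n j) (X i \<omega>)) / of_nat n * emeasure \<mu> (Q n j \<inter> A))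
        else emeasure \<mu> A)" for \<omega>
    proof (cases "ok n \<omega>")
      case True
      interpret cell_transport "\<nu> n \<omega>" \<mu> "{..<m n}" "Q n" by (rule transport[OF n True])
      show ?thesis
        using emeasure_target[OF A] True \<mu>t_ok[OF True]
        by (simp add: weight_def \<nu>_def emeasure_empirical_measure)
    qed (simp add: \<mu>t_not_ok)
    then show "(\<lambda>\<omega>. emeasure (\<mu>t n \<omega>) A) \<in> borel_measurable M"
      by (subst measurable_cong, assumption) measurable
  qed
  moreover have "absolutely_continuous \<mu> (\<mu>t n \<omega>)" for n \<omega>
    unfolding \<mu>t_def by (rule absolutely_continuousI_density) simp
  \<comment> \<open>On this almost sure event \<open>ok n \<omega>\<close> reduces to
    \<open>good n\<close>, which holds eventually.\<close>
  moreover have all_K: "AE \<omega> in M. \<forall>i\<in>{1..}. X i \<omega> \<in> K"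
  proof (subst AE_ball_countable)
    show "\<forall>i\<in>{1..}. AE \<omega> in M. X i \<omega> \<in> K"
    proof
      fix i :: nat assume "i \<in> {1..}"
      then have i: "i \<ge> 1" by simp
      have "AE x in distr M borel (X i). x \<in> K" unfolding distr[OF i] by (rule K(2))
      then show "AE \<omega> in M. X i \<omega> \<in> K" using i by (subst (asm) AE_distr_iff) auto
    qed
  qed auto
  moreover have "AE \<omega> in M. (\<lambda>n. d_infty (empirical_measure n (\<lambda>i. X i \<omega>)) (\<mu>t n \<omega>) / ennreal (\<epsilon> n)) \<longlonglongrightarrow> 0"
    using all_K
  proof (rule eventually_mono)
    fix \<omega> assume K\<omega>: "\<forall>i\<in>{1..}. X i \<omega> \<in> K"
    have "(\<lambda>n. ennreal (4 * (\<delta> n / \<epsilon> n))) \<longlonglongrightarrow> ennreal (4 * 0)"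
      by (intro tendsto_ennrealI tendsto_intros \<epsilon>)
    then have lim: "(\<lambda>n. ennreal (4 * (\<delta> n / \<epsilon> n))) \<longlonglongrightarrow> 0" by simp
    have "\<forall>\<^sub>F n in sequentially. d_infty (empirical_measure n (\<lambda>i. X i \<omega>)) (\<mu>t n \<omega>) / ennreal (\<epsilon> n)
        \<le> ennreal (4 * (\<delta> n / \<epsilon> n))"
      using good eventually_ge_at_top[of 1]
    proof eventually_elim
      case (elim n)
      then have ok: "ok n \<omega>" using K\<omega> by (auto simp: ok_def)
      interpret cell_transport "\<nu> n \<omega>" \<mu> "{..<m n}" "Q n" by (rule transport[OF elim(2) ok])
      have "d_infty (\<nu> n \<omega>) (\<mu>t n \<omega>) \<le> ennreal (4 * \<delta> n)"
        unfolding \<mu>t_ok[OF ok] using Q(3)[OF elim(1)] by (intro d_infty_target_le) auto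
      then have "d_infty (\<nu> n \<omega>) (\<mu>t n \<omega>) / ennreal (\<epsilon> n) \<le> ennreal (4 * \<delta> n) / ennreal (\<epsilon> n)"
        by (rule divide_right_mono_ennreal)
      also have "\<dots> = ennreal (4 * (\<delta> n / \<epsilon> n))"
        using elim \<epsilon>(1)[of n] by (simp add: divide_ennreal good_def)
      finally show ?case by (simp add: \<nu>_def)
    qed
    then show "(\<lambda>n. d_infty (empirical_measure n (\<lambda>i. X i \<omega>)) (\<mu>t n \<omega>) / ennreal (\<epsilon> n)) \<longlonglongrightarrow> 0"
      by (intro tendsto_sandwich[OF _ _ tendsto_const lim]) auto
  qed
  moreover have "AE \<omega> in M. \<exists>f :: nat \<Rightarrow> 'b \<Rightarrow> real.
       (\<forall>n\<ge>1. RN_version \<mu> (\<mu>t n \<omega>) (f n)) \<and> uniform_limit K f (\<lambda>_. 1) sequentially"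
  proof -
    \<comment> \<open>This is the sample size times the guaranteed mass of a cell; it differs from
      \<open>n * \<delta> n ^ d\<close> by a positive constant, so it still dominates
      \<open>ln n\<close>.\<close>
    define t where "t n = real n * (\<kappa> * (\<delta> n / 2) ^ d)" for n
    have "filterlim (\<lambda>n. (\<kappa> / 2 ^ d) * (real n * \<delta> n ^ d / ln (real n))) at_top sequentially"
      using regular(1) by (intro filterlim_tendsto_pos_mult_at_top[OF tendsto_const _ \<delta>(3)]) auto
    then have t: "filterlim (\<lambda>n. t n / ln (real n)) at_top sequentially"
      by (simp add: t_def power_divide mult_ac)
    have lower: "\<forall>\<^sub>F n in sequentially. \<forall>j\<in>{..<m n}. t n \<le> real n * measure \<mu> (Q n j)"
      using good by eventually_elim (auto simp: t_def intro!: mult_left_mono Q(2))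
    have "AE \<omega> in M. \<forall>\<eta>>0. \<forall>\<^sub>F n in sequentially. \<forall>j\<in>{..<m n}.
        \<bar>measure (\<nu> n \<omega>) (Q n j) / measure \<mu> (Q n j) - 1\<bar> < \<eta>"
      unfolding \<nu>_def
      by (rule empirical_cells_converge[OF ind distr _ _ disj t lower]) auto
    then show ?thesis
      using all_K
    proof eventually_elim
      case (elim \<omega>)
      have "RN_version \<mu> (\<mu>t n \<omega>) (f n \<omega>)" for n
        unfolding RN_version_def
      proof (intro conjI allI)
        show "0 \<le> f n \<omega> y" for y by (simp add: f_def cell_density_nonneg)
        \<comment> \<open>\<open>\<mu>t\<close> was defined by the density \<open>f\<close>, so
          uniqueness of Radon-Nikodym derivatives identifies \<open>f\<close> as a version.\<close>
        show "AE y in \<mu>. ennreal (f n \<omega> y) = RN_deriv \<mu> (\<mu>t n \<omega>) y"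
          by (rule \<mu>.RN_deriv_unique) (simp_all add: \<mu>t_def)
      qed simp
      moreover have "uniform_limit K (\<lambda>n. f n \<omega>) (\<lambda>_. 1) sequentially"
        unfolding uniform_limit_iff
      proof (intro allI impI)
        fix e :: real assume "0 < e"
        with elim(1) have "\<forall>\<^sub>F n in sequentially. \<forall>j\<in>{..<m n}.
            \<bar>measure (\<nu> n \<omega>) (Q n j) / measure \<mu> (Q n j) - 1\<bar> < e" by blast
        then show "\<forall>\<^sub>F n in sequentially. \<forall>y\<in>K. dist (f n \<omega> y) 1 < e"
          using good
        proof eventually_elim
          case (elim n)
          show ?case
          proof
            fix y assume "y \<in> K"
            \<comment> \<open>Each point of \<open>K\<close> lies in a cell, so uniformity over
              \<open>K\<close> is uniformity over the finitely many ratios.\<close>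
            then obtain j where j: "j < m n" "y \<in> Q n j" using Q(1)[OF elim(2)] by blast
            have "ok n \<omega>" using elim(2) \<open>\<forall>i\<in>{1..}. X i \<omega> \<in> K\<close> by (auto simp: ok_def)
            then have "f n \<omega> y = measure (\<nu> n \<omega>) (Q n j) / measure \<mu> (Q n j)"
              using j by (simp add: f_def cell_density_eq[OF finite_lessThan disj, of j])
            then show "dist (f n \<omega> y) 1 < e" using elim(1) j by (simp add: dist_real_def)
          qed
        qed
      qed
      ultimately show ?case by (intro exI[of _ "\<lambda>n. f n \<omega>"] conjI allI impI)
    qed
  qed
  ultimately show ?thesis by (intro exI[of _ \<mu>t] conjI allI ballI impI)
qed

section \<open>Choice of the cell scale for the given rate\<close>

theorem lemma3p1:
  fixes \<Omega> :: "'a::euclidean_space set"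
    and \<rho> :: "'a \<Rightarrow> real"
    and \<mu> :: "'a measure"
    and c C :: real
    and \<epsilon> :: "nat \<Rightarrow> real"
    and M :: "'w measure"
    and X :: "nat \<Rightarrow> 'w \<Rightarrow> 'a"
  assumes dim: "DIM('a) \<ge> 2"
    and Omega: "open \<Omega>" "bounded \<Omega>" "lipschitz_boundary \<Omega>"
    and rho_cont: "continuous_on (closure \<Omega>) \<rho>"
    and rho_bounds: "0 < c" "\<And>x. x \<in> closure \<Omega> \<Longrightarrow> c \<le> \<rho> x \<and> \<rho> x \<le> C"
    and mu: "prob_space \<mu>"
      "\<mu> = density lborel (\<lambda>x. ennreal (indicator (closure \<Omega>) x * \<rho> x))"
    and eps_pos: "\<And>n. n \<ge> 1 \<Longrightarrow> \<epsilon> n > 0"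
    and eps_lim: "\<epsilon> \<longlonglongrightarrow> 0"
    and eps_rate: "(\<lambda>n. ln (real n) powr (1 / real DIM('a)) /
                        (\<epsilon> n * real n powr (1 / real DIM('a)))) \<longlonglongrightarrow> 0"
    and M: "prob_space M"
    and X_indep: "prob_space.indep_vars M (\<lambda>_. borel) X {1..}"
    and X_distr: "\<And>i. i \<ge> 1 \<Longrightarrow> distr M borel (X i) = \<mu>"
  shows "\<exists>\<mu>t :: nat \<Rightarrow> 'w \<Rightarrow> 'a measure.
    (\<forall>n\<ge>1. \<mu>t n \<in> M \<rightarrow>\<^sub>M prob_algebra borel) \<and>
    (\<forall>n\<ge>1. \<forall>\<omega>\<in>space M. absolutely_continuous \<mu> (\<mu>t n \<omega>)) \<and>
    (AE \<omega> in M.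
       (\<lambda>n. d_infty (empirical_measure n (\<lambda>i. X i \<omega>)) (\<mu>t n \<omega>) / ennreal (\<epsilon> n))
         \<longlonglongrightarrow> 0) \<and>
    (AE \<omega> in M. \<exists>f :: nat \<Rightarrow> 'a \<Rightarrow> real.
       (\<forall>n\<ge>1. RN_version \<mu> (\<mu>t n \<omega>) (f n)) \<and>
       uniform_limit (closure \<Omega>) f (\<lambda>_. 1) sequentially)"
proof -
  interpret prob_space M by fact
  obtain \<kappa> r where regular: "0 < \<kappa>" "0 < r"
    "\<And>x s. x \<in> closure \<Omega> \<Longrightarrow> 0 < s \<Longrightarrow> s \<le> r \<Longrightarrow> \<kappa> * s ^ DIM('a) \<le> measure \<mu> (ball x s)"
    using lower_regular_density[OF Omega mu rho_cont rho_bounds(1)] rho_bounds(2) by metis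
  \<comment> \<open>The geometric mean of \<open>a\<close> and \<open>\<epsilon>\<close> lies strictly between the two scales.\<close>
  define a where "a n = ln (real n) powr (1 / real DIM('a)) / real n powr (1 / real DIM('a))" for n
  define \<delta> where "\<delta> n = sqrt (a n * \<epsilon> n)" for n
  have rate: "(\<lambda>n. a n / \<epsilon> n) \<longlonglongrightarrow> 0"
    using eps_rate by (simp add: a_def mult.commute)
  have pos: "\<forall>\<^sub>F n in sequentially. 0 < a n \<and> 0 < \<epsilon> n \<and> a n ^ DIM('a) = ln (real n) / real n"
    \<comment> \<open>\<open>n = 1\<close> must be excluded, since \<open>ln 1 = 0\<close> would
      make \<open>a n\<close> vanish.\<close>
    using eventually_gt_at_top[of 1]
  proof eventually_elim
    case (elim n)
    then show ?case
      using eps_pos[of n] by (simp add: a_def power_divide powr_powr flip: powr_realpow)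
  qed
  have \<delta>_\<epsilon>: "(\<lambda>n. \<delta> n / \<epsilon> n) \<longlonglongrightarrow> 0"
  proof (rule Lim_transform_eventually)
    show "(\<lambda>n. sqrt (a n / \<epsilon> n)) \<longlonglongrightarrow> 0" using tendsto_real_sqrt[OF rate] by simp
    show "\<forall>\<^sub>F n in sequentially. sqrt (a n / \<epsilon> n) = \<delta> n / \<epsilon> n"
      using pos by eventually_elim (auto simp: \<delta>_def real_sqrt_mult real_sqrt_divide field_simps)
  qed
  have \<delta>_0: "\<delta> \<longlonglongrightarrow> 0"
  proof (rule Lim_transform_eventually)
    show "(\<lambda>n. \<delta> n / \<epsilon> n * \<epsilon> n) \<longlonglongrightarrow> 0" using tendsto_mult[OF \<delta>_\<epsilon> eps_lim] by simp
    show "\<forall>\<^sub>F n in sequentially. \<delta> n / \<epsilon> n * \<epsilon> n = \<delta> n" using pos by eventually_elim auto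
  qed
  \<comment> \<open>Since \<open>\<delta> n\<close> squared is \<open>a n * \<epsilon> n\<close>,
    the ratio \<open>\<epsilon> n / \<delta> n\<close> equals \<open>\<delta> n / a n\<close>. Its
    power with exponent \<open>DIM('a)\<close> is the quantity that must diverge, as the same power
    of \<open>a n\<close> is \<open>ln n / n\<close>.\<close>
  have "filterlim (\<lambda>n. inverse (\<delta> n / \<epsilon> n)) at_top sequentially"
    using pos by (intro filterlim_inverse_at_top[OF \<delta>_\<epsilon>]) (auto simp: \<delta>_def elim!: eventually_mono)
  then have "filterlim (\<lambda>n. inverse (\<delta> n / \<epsilon> n) ^ DIM('a)) at_top sequentially"
    by (intro filterlim_pow_at_top) auto
  moreover have "\<forall>\<^sub>F n in sequentially. inverse (\<delta> n / \<epsilon> n) ^ DIM('a) = real n * \<delta> n ^ DIM('a) / ln (real n)"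
    using pos eventually_gt_at_top[of 1]
  proof eventually_elim
    case (elim n)
    have "inverse (\<delta> n / \<epsilon> n) = \<delta> n / a n"
      using elim by (simp add: \<delta>_def field_simps real_sqrt_mult)
    then have "inverse (\<delta> n / \<epsilon> n) ^ DIM('a) = \<delta> n ^ DIM('a) / (ln (real n) / real n)"
      using elim by (simp add: power_divide)
    then show ?case by (simp add: mult.commute)
  qed
  ultimately have \<delta>_rate: "filterlim (\<lambda>n. real n * \<delta> n ^ DIM('a) / ln (real n)) at_top sequentially"
    by (rule filterlim_cong[THEN iffD1, OF refl refl, rotated])
  have \<delta>_pos: "\<forall>\<^sub>F n in sequentially. 0 < \<delta> n" using pos by eventually_elim (simp add: \<delta>_def)
  have supp: "AE x in \<mu>. x \<in> closure \<Omega>"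
  proof -
    have [measurable]: "(\<lambda>x. indicator (closure \<Omega>) x * \<rho> x) \<in> borel_measurable borel"
      using borel_measurable_continuous_on_indicator[OF _ rho_cont] by simp
    show ?thesis unfolding mu(2) by (subst AE_density, measurable) (auto simp: indicator_def)
  qed
  have K: "compact (closure \<Omega>)" using Omega(2) by simp
  show ?thesis
    by (rule empirical_measure_cell_approximation[OF X_indep X_distr K supp regular \<delta>_pos \<delta>_0 \<delta>_rate eps_pos \<delta>_\<epsilon>])
qed

end
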